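(* Let $(S,<)$ be a well-founded partially ordered set. Then the Star Hydra rewrite relation $\to_{\mathit{SH}}$ on finite trees with nodes labeled from $S$ is terminating: there is no infinite sequence $h_0\to_{\mathit{SH}}h_1\to_{\mathit{SH}}h_2\to_{\mathit{SH}}\cdots$.
   Context: Trees are finite, rooted and unordered; $n(t_1,\ldots,t_k)$ ($k\ge0$) denotes the tree with root label $n$ and immediate subtrees $t_1,\ldots,t_k$, the order of arguments being irrelevant; a leaf labeled $\alpha$ is written $\alpha$. A Star Hydra is a finite tree with nodes labeled from $S$. For every $s\in S$ let $\underline{s}$ be a fresh symbol and $\underline{S}=\{\underline{s}\mid s\in S\}$. On finite trees labeled with $S\cup\underline{S}$ consider the following rewrite rules, applicable at any subtree, where $n,m,\alpha,\beta_i\in S$ and $\vec x,\vec y$ stand for arbitrary finite (possibly empty) sequences of trees: (chop) $n(\alpha,\vec x)\to\underline{n}(\underline{\beta_1},\ldots,\underline{\beta_k},\vec x)$ for $k\ge0$ and $\beta_1,\ldots,\beta_k<\alpha$ (here $\alpha$ and the $\underline{\beta_i}$ are leaves); (propagate) $n(\underline{m}(\vec x),\vec y)\to\underline{n}(\underline{m}(\vec x),\vec y)$; (widen) $\underline{n}(\underline{m}(\vec x),\vec y)\to\underline{n}(\underline{m}(\vec x),\ldots,\underline{m}(\vec x),\vec y)$ with $0$ or more copies of $\underline{m}(\vec x)$ on the right; (lengthen) $\underline{n}(\vec x)\to\underline{m}(\underline{n}(\vec x))$ if $m<n$; (waive) $\underline{m}(\vec x)\to m(\vec x)$. The Star Hydra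 rewrite relation on trees labeled from $S$ is the composition $$\to_{\mathit{SH}}\;=\;\to_{\mathrm{chop}}\cdot\to_{\mathrm{propagate}}^!\cdot(\to_{\mathrm{widen}}\cup\to_{\mathrm{lengthen}})^*\cdot\to_{\mathrm{waive}}^!,$$ where compositions are read left to right, and $R^!$ denotes a maximal reduction: $x\mathrel{R^!}y$ iff $x\mathrel{R^*}y$ and there is no $z$ with $y\mathrel{R}z$. *)

theory Defs
  imports "HOL-Library.Multiset"
begin

text \<open>Immediate subtrees form a multiset because trees are unordered.\<close>

datatype 'a tree = Node 'a "'a tree multiset"

abbreviation leaf :: "'a \<Rightarrow> 'a tree" where
  "leaf a \<equiv> Node a {#}"

text \<open>The disjoint union of the labels with their underlined copies.\<close>

datatype 's label = Plain 's | Underlined 's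

text \<open>
  The rules at the root of a tree. The parameters are the carrier \<open>S\<close> and its strict order.
  Membership in \<open>S\<close> is only asked of labels displayed in a rule: the multisets \<open>X\<close> and \<open>Y\<close> of
  remaining subtrees are inherited from the redex, and \<open>star_hydra_step\<close> starts from a tree
  labeled in \<open>S\<close>.
\<close>

inductive chop :: "'s set \<Rightarrow> ('s \<Rightarrow> 's \<Rightarrow> bool) \<Rightarrow> 's label tree \<Rightarrow> 's label tree \<Rightarrow> bool"
  for S lt where
  "\<lbrakk>n \<in> S; \<alpha> \<in> S; \<forall>\<beta>\<in>#B. \<beta> \<in> S \<and> lt \<beta> \<alpha>\<rbrakk> \<Longrightarrow>
    chop S lt
      (Node (Plain n) (add_mset (leaf (Plain \<alpha>)) X))
      (Node (Underlined n) ({#leaf (Underlined \<beta>). \<beta> \<in># B#} + X))"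

inductive propagate :: "'s set \<Rightarrow> 's label tree \<Rightarrow> 's label tree \<Rightarrow> bool"
  for S where
  "\<lbrakk>n \<in> S; m \<in> S\<rbrakk> \<Longrightarrow>
    propagate S
      (Node (Plain n) (add_mset (Node (Underlined m) X) Y))
      (Node (Underlined n) (add_mset (Node (Underlined m) X) Y))"

inductive widen :: "'s set \<Rightarrow> 's label tree \<Rightarrow> 's label tree \<Rightarrow> bool"
  for S where
  "\<lbrakk>n \<in> S; m \<in> S\<rbrakk> \<Longrightarrow>
    widen S
      (Node (Underlined n) (add_mset (Node (Underlined m) X) Y))
      (Node (Underlined n) (replicate_mset k (Node (Underlined m) X) + Y))"

inductive lengthen :: "'s set \<Rightarrow> ('s \<Rightarrow> 's \<Rightarrow> bool) \<Rightarrow> 's label tree \<Rightarrow> 's label tree \<Rightarrow> bool"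
  for S lt where
  "\<lbrakk>n \<in> S; m \<in> S; lt m n\<rbrakk> \<Longrightarrow>
    lengthen S lt
      (Node (Underlined n) X)
      (Node (Underlined m) {#Node (Underlined n) X#})"

inductive waive :: "'s set \<Rightarrow> 's label tree \<Rightarrow> 's label tree \<Rightarrow> bool"
  for S where
  "m \<in> S \<Longrightarrow> waive S (Node (Underlined m) X) (Node (Plain m) X)"

inductive at_subtree :: "('a tree \<Rightarrow> 'a tree \<Rightarrow> bool) \<Rightarrow> 'a tree \<Rightarrow> 'a tree \<Rightarrow> bool"
  for R where
  root: "R t u \<Longrightarrow> at_subtree R t u"
| below: "at_subtree R t u \<Longrightarrow> at_subtree R (Node a (add_mset t X)) (Node a (add_mset u X))"

definition maximal_reduction :: "('a \<Rightarrow> 'a \<Rightarrow> bool) \<Rightarrow> 'a \<Rightarrow> 'a \<Rightarrow> bool" where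
  "maximal_reduction R x y \<longleftrightarrow> R\<^sup>*\<^sup>* x y \<and> (\<nexists>z. R y z)"

text \<open>
  Trees labeled from \<open>S\<close> are regarded, via \<open>Plain\<close>, as trees over labels and underlined labels.
\<close>

definition star_hydra_step :: "'s set \<Rightarrow> ('s \<Rightarrow> 's \<Rightarrow> bool) \<Rightarrow> 's tree \<Rightarrow> 's tree \<Rightarrow> bool" where
  "star_hydra_step S lt h h' \<longleftrightarrow>
    set_tree h \<subseteq> S \<and> set_tree h' \<subseteq> S \<and>
    (at_subtree (chop S lt)
      OO maximal_reduction (at_subtree (propagate S))
      OO (sup (at_subtree (widen S)) (at_subtree (lengthen S lt)))\<^sup>*\<^sup>*
      OO maximal_reduction (at_subtree (waive S)))
    (map_tree Plain h) (map_tree Plain h')"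

end

theory Submission
  imports Defs
begin

text \<open>
  Underlining a subtree records that it is already strictly smaller, in a multiset path order
  over \<open>S\<close>, than the subtree it stems from. After a chop and maximal propagation the whole tree
  is underlined at its root, widening and lengthening preserve the meaning of the underlining,
  and waiving forgets it. The smaller trees are built as reducts, and the order on reducts is
  well-founded by induction on the root label, then on the multiset of immediate subtrees,
  and finally on the construction of the reduct.
\<close>

section \<open>Reducts and rewriting inside them\<close>

abbreviation plain :: "'s tree \<Rightarrow> 's label tree" where
  "plain \<equiv> map_tree Plain"

primrec label_of :: "'s label \<Rightarrow> 's" where
  "label_of (Plain s) = s"
| "label_of (Underlined s) = s"

abbreviation erase :: "'s label tree \<Rightarrow> 's tree" where
  "erase \<equiv> map_tree label_of"

lemma erase_plain [simp]: "erase (plain t) = t"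
  by (simp add: tree.map_comp o_def tree.map_ident)

text \<open>
  The two clauses are those of the multiset path order: in \<open>same\<close> the subtrees \<open>T\<close> are replaced by
  smaller ones, while \<open>Z\<close> is kept and hence not underlined.
\<close>

inductive reduct :: "'s set \<Rightarrow> ('s \<Rightarrow> 's \<Rightarrow> bool) \<Rightarrow> 's tree \<Rightarrow> 's label tree \<Rightarrow> bool"
  for S lt where
  same: "\<lbrakk>n \<in> S; T \<noteq> {#}; \<forall>w\<in>#W. \<exists>t\<in>#T. reduct S lt t w\<rbrakk> \<Longrightarrow>
    reduct S lt (Node n (Z + T)) (Node (Underlined n) (image_mset plain Z + W))"
| lower: "\<lbrakk>m \<in> S; n \<in> S; lt m n; \<forall>u\<in>#U. reduct S lt (Node n X) u\<rbrakk> \<Longrightarrow>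
    reduct S lt (Node n X) (Node (Underlined m) U)"

lemma reduct_Underlined:
  assumes "reduct S lt t u"
  obtains m X where "m \<in> S" and "u = Node (Underlined m) X"
  using assms by cases auto

text \<open>Each redex carries an underlined label, hence so does every tree containing it, whereas
  \<open>plain t\<close> has none.\<close>

lemma at_subtree_plain:
  assumes "\<And>u v. R u v \<Longrightarrow> \<not> set_tree u \<subseteq> range Plain"
  shows "\<not> at_subtree R (plain t) v"
proof -
  have "\<not> set_tree u \<subseteq> range Plain" if "at_subtree R u v" for u
    using that by induction (use assms in auto)
  moreover have "set_tree (plain t) \<subseteq> range Plain"
    by (auto simp: tree.set_map)
  ultimately show ?thesis by blast
qed

text \<open>An underlined root tells the summand \<open>W\<close> of a reduct from the untouched summand \<open>Z\<close>.\<close>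

lemma plain_neq_Underlined [simp]: "plain t \<noteq> Node (Underlined m) X"
  by (cases t) simp

lemma Underlined_notin_plain [simp]: "Node (Underlined m) X \<notin># image_mset plain Z"
  by (metis imageE plain_neq_Underlined set_image_mset)

lemma add_mset_eq_plusE:
  assumes "add_mset x Y = image_mset f Z + W" and "x \<notin># image_mset f Z"
  obtains W' where "W = add_mset x W'" and "Y = image_mset f Z + W'"
proof -
  have "x \<in># W"
    using assms by (metis union_iff union_single_eq_member)
  then obtain W' where "W = add_mset x W'"
    by (meson multi_member_split)
  with assms(1) that show thesis by simp
qed

text \<open>In the clause \<open>same\<close>, a child that rewrites cannot be plain, so it lies in
  \<open>W\<close> and stays a reduct of the same member of \<open>T\<close>. Only the root case is
  specific to the rule \<open>R\<close>.\<close>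

lemma reduct_at_subtree:
  assumes root: "\<And>t u v. R u v \<Longrightarrow> reduct S lt t u \<Longrightarrow> reduct S lt t v"
    and redex: "\<And>u v. R u v \<Longrightarrow> \<not> set_tree u \<subseteq> range Plain"
    and "at_subtree R u v" and "reduct S lt t u"
  shows "reduct S lt t v"
  using assms(3,4)
proof (induction arbitrary: t)
  case (root u v)
  then show ?case using assms(1) by blast
next
  case (below u v a X)
  have "\<not> at_subtree R (plain s) v" for s
    by (rule at_subtree_plain) (rule redex)
  then have np: "u \<notin># image_mset plain Z" for Z
    using below.hyps by auto
  from below.prems show ?case
  proof cases
    case (same n T W Z)
    then obtain W' where W: "W = add_mset u W'" "X = image_mset plain Z + W'"
      using same(3) np by (metis add_mset_eq_plusE)
    have "\<forall>w\<in>#add_mset v W'. \<exists>t\<in>#T. reduct S lt t w"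
      using same(6) W(1) below.IH by auto
    from reduct.same[OF same(4,5) this, of Z] show ?thesis
      using same(1,2) W(2) by simp
  next
    case (lower m n X')
    then show ?thesis
      using below.IH by (auto intro!: reduct.lower)
  qed
qed

section \<open>Widening and lengthening\<close>

text \<open>Both clauses constrain the new subtrees one by one, so any number of copies is allowed,
  including none.\<close>

lemma reduct_widen:
  assumes "widen S u v" and "reduct S lt t u"
  shows "reduct S lt t v"
  using assms(1)
proof cases
  case (1 n m X Y k)
  let ?x = "Node (Underlined m) X"
  from assms(2)[unfolded 1(1)] show ?thesis
  proof cases
    case (same T W Z)
    then obtain W' where W: "W = add_mset ?x W'" "Y = image_mset plain Z + W'"
      using same(2) Underlined_notin_plain by (metis add_mset_eq_plusE)
    have "\<forall>w\<in>#replicate_mset k ?x + W'. \<exists>t\<in>#T. reduct S lt t w"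
      using same(5) W(1) by (auto split: if_splits)
    from reduct.same[OF same(3,4) this, of Z] show ?thesis
      using same(1) 1(2) W(2) by (simp add: ac_simps)
  next
    case (lower n' X')
    then show ?thesis
      using 1(2) by (auto intro!: reduct.lower split: if_splits)
  qed
qed

text \<open>The root label of \<open>u\<close> is that of \<open>t\<close> or below it, so
  \<open>m\<close> is strictly below the latter, and \<open>lower\<close> applies with
  \<open>u\<close> as the only child.\<close>

lemma reduct_lengthen:
  assumes "transp_on S lt" and "lengthen S lt u v" and "reduct S lt t u"
  shows "reduct S lt t v"
  using assms(2)
proof cases
  case (1 n m X)
  obtain k Y where t: "t = Node k Y" by (cases t)
  from assms(3)[unfolded 1(1) t] have "k \<in> S" and "k = n \<or> lt n k"
    by (auto elim!: reduct.cases)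
  then have "lt m k"
    using transp_onD[OF assms(1), of m n k] 1(3-5) by blast
  then show ?thesis
    using assms(3) 1 t \<open>k \<in> S\<close> by (simp add: reduct.lower)
qed

text \<open>
  The trees met during propagation: the upper part of the path from the root to the chopped node
  is not underlined yet.
\<close>

inductive pending :: "'s set \<Rightarrow> ('s \<Rightarrow> 's \<Rightarrow> bool) \<Rightarrow> 's tree \<Rightarrow> 's label tree \<Rightarrow> bool"
  for S lt where
  reduct: "reduct S lt t u \<Longrightarrow> pending S lt t u"
| path: "\<lbrakk>n \<in> S; pending S lt t u\<rbrakk> \<Longrightarrow>
    pending S lt (Node n (add_mset t X)) (Node (Plain n) (add_mset u (image_mset plain X)))"

section \<open>Chopping and maximal propagation\<close>

lemma reduct_leaf:
  assumes "m \<in> S" "n \<in> S" "lt m n"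
  shows "reduct S lt (Node n X) (leaf (Underlined m))"
  using assms by (simp add: reduct.lower)

lemma plain_eq_NodeE:
  assumes "plain h = Node b (add_mset u X)"
  obtains n t Z where "h = Node n (add_mset t Z)" "b = Plain n" "plain t = u" "X = image_mset plain Z"
proof -
  obtain n M where h: "h = Node n M" by (cases h)
  with assms have "image_mset plain M = add_mset u X" by simp
  from msed_map_invR[OF this] show thesis
    using that h assms by auto
qed

lemma pending_chop:
  assumes "at_subtree (chop S lt) (plain h) u" and "set_tree h \<subseteq> S"
  shows "pending S lt h u"
  using assms
proof (induction "plain h" u arbitrary: h)
  case (root u)
  from root.hyps show ?case
  proof cases
    case (1 n \<alpha> B X)
    from 1(1) obtain n' a Z where h: "h = Node n' (add_mset a Z)" "Plain n = Plain n'"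
      "plain a = leaf (Plain \<alpha>)" "X = image_mset plain Z"
      by (rule plain_eq_NodeE)
    have a: "a = leaf \<alpha>" using h(3) by (cases a) auto
    \<comment> \<open>The chopped leaf alone plays the role of \<open>T\<close>; the new leaves form
      \<open>W\<close>, possibly empty.\<close>
    have "\<forall>w\<in>#{#leaf (Underlined \<beta>). \<beta> \<in># B#}. \<exists>t\<in>#{#a#}. reduct S lt t w"
      using 1 a by (auto intro: reduct_leaf)
    from reduct.same[OF 1(3) _ this, of Z] show ?thesis
      using 1(2) h by (simp add: ac_simps pending.reduct)
  qed
next
  case (below u v b X)
  from below.hyps(3)[symmetric] obtain n t Z where h: "h = Node n (add_mset t Z)" "b = Plain n"
    "plain t = u" "X = image_mset plain Z"
    by (rule plain_eq_NodeE)
  have "pending S lt t v"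
    using below.hyps(2)[of t] below.prems h by auto
  then show ?case
    using h below.prems by (auto intro: pending.path)
qed

lemma widen_redex: "widen S u v \<Longrightarrow> \<not> set_tree u \<subseteq> range Plain"
  by (erule widen.cases) auto

lemma lengthen_redex: "lengthen S lt u v \<Longrightarrow> \<not> set_tree u \<subseteq> range Plain"
  by (erule lengthen.cases) auto

lemma propagate_redex: "propagate S u v \<Longrightarrow> \<not> set_tree u \<subseteq> range Plain"
  by (erule propagate.cases) auto

lemma at_subtree_propagate_plain: "\<not> at_subtree (propagate S) (plain t) v"
  by (rule at_subtree_plain) (rule propagate_redex)

lemma not_propagate_reduct: "reduct S lt t u \<Longrightarrow> \<not> propagate S u v"
  by (rule notI, erule reduct_Underlined, erule propagate.cases) simp

lemma reduct_at_subtree_propagate: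
  assumes "at_subtree (propagate S) u v" and "reduct S lt t u"
  shows "reduct S lt t v"
  using _ propagate_redex assms
  by (rule reduct_at_subtree) (simp_all add: not_propagate_reduct)

lemma reduct_at_subtree_widen:
  assumes "at_subtree (widen S) u v" and "reduct S lt t u"
  shows "reduct S lt t v"
  using reduct_widen widen_redex assms by (rule reduct_at_subtree)

lemma reduct_at_subtree_lengthen:
  assumes "transp_on S lt" and "at_subtree (lengthen S lt) u v" and "reduct S lt t u"
  shows "reduct S lt t v"
  using reduct_lengthen[OF assms(1)] lengthen_redex assms(2,3) by (rule reduct_at_subtree)

lemma pending_Underlined:
  "pending S lt t (Node (Underlined m) X) \<Longrightarrow> reduct S lt t (Node (Underlined m) X)"
  by (erule pending.cases) simp_all

lemma reduct_path:
  assumes "n \<in> S" and "reduct S lt t u"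
  shows "reduct S lt (Node n (add_mset t X)) (Node (Underlined n) (add_mset u (image_mset plain X)))"
  using reduct.same[of n S "{#t#}" "{#u#}" lt X] assms by simp

text \<open>The siblings along the path are plain, so propagation at a path node can only be
  triggered by the child on the path, which is then already a reduct.\<close>

lemma pending_propagate:
  assumes "pending S lt t u" and "at_subtree (propagate S) u v"
  shows "pending S lt t v"
  using assms
proof (induction arbitrary: v)
  case (reduct t u)
  then show ?case
    by (blast intro: pending.reduct reduct_at_subtree_propagate)
next
  case (path n t u X)
  from path.prems show ?case
  proof cases
    case root
    then obtain m X' Y where
      v: "v = Node (Underlined n) (add_mset u (image_mset plain X))" and
      eq: "add_mset u (image_mset plain X) = add_mset (Node (Underlined m) X') Y"
      by (auto elim!: propagate.cases)
    have "Node (Underlined m) X' \<in># add_mset u (image_mset plain X)"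
      by (simp add: eq)
    then have "u = Node (Underlined m) X'"
      using Underlined_notin_plain[of m X' X] by auto
    then have "reduct S lt t u"
      using path.hyps(2) pending_Underlined by metis
    then show ?thesis
      using path.hyps(1) v by (auto intro!: pending.reduct reduct_path)
  next
    case (below w w' Y)
    have "w \<noteq> plain s" for s
      using below(3) at_subtree_propagate_plain by metis
    moreover have "w \<in># add_mset u (image_mset plain X)"
      by (simp add: below(1))
    ultimately have w: "w = u" by auto
    with below(1) have "Y = image_mset plain X" by simp
    then show ?thesis
      using below(2,3) w path by (simp add: pending.path)
  qed
qed

text \<open>If a path node were left, its child would be a reduct by induction, hence underlined,
  and propagation would apply.\<close>

lemma pending_normal:
  assumes "pending S lt t u" and "\<nexists>v. at_subtree (propagate S) u v"
  shows "reduct S lt t u"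
  using assms
proof induction
  case (path n t u X)
  have "reduct S lt t u"
    using path.IH path.prems at_subtree.below by metis
  then obtain m X' where "m \<in> S" "u = Node (Underlined m) X'"
    by (rule reduct_Underlined)
  then have False
    using path.prems path.hyps(1) by (auto intro: at_subtree.root propagate.intros)
  then show ?case ..
qed

lemma erase_waive: "at_subtree (waive S) u v \<Longrightarrow> erase u = erase v"
  by (induction rule: at_subtree.induct) (auto elim!: waive.cases)

lemma star_hydra_step_reduct:
  assumes "transp_on S lt" and "star_hydra_step S lt h h'"
  obtains u where "reduct S lt h u" and "h' = erase u"
proof -
  let ?R = "sup (at_subtree (widen S)) (at_subtree (lengthen S lt))"
  obtain x y z where h: "set_tree h \<subseteq> S"
    and x: "at_subtree (chop S lt) (plain h) x"
    and y: "(at_subtree (propagate S))\<^sup>*\<^sup>* x y" "\<nexists>v. at_subtree (propagate S) y v"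
    and z: "?R\<^sup>*\<^sup>* y z"
    and w: "(at_subtree (waive S))\<^sup>*\<^sup>* z (plain h')"
    using assms(2) unfolding star_hydra_step_def maximal_reduction_def by blast
  from y(1) have "pending S lt h y"
    by induction (use pending_chop[OF x h] pending_propagate in blast)+
  then have "reduct S lt h y"
    using y(2) by (rule pending_normal)
  with z have "reduct S lt h z"
  proof induction
    case (step u v)
    then show ?case
      using reduct_at_subtree_widen reduct_at_subtree_lengthen[OF assms(1)]
      unfolding sup_apply sup_bool_def by blast
  qed
  moreover from w have "erase z = erase (plain h')"
    by induction (auto dest: erase_waive)
  ultimately show thesis
    using that by simp
qed

section \<open>Well-foundedness and termination\<close>

definition less_tree :: "'s set \<Rightarrow> ('s \<Rightarrow> 's \<Rightarrow> bool) \<Rightarrow> 's tree \<Rightarrow> 's tree \<Rightarrow> bool" where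
  "less_tree S lt v t \<longleftrightarrow> (\<exists>u. reduct S lt t u \<and> v = erase u)"

text \<open>Elements not accessible for \<open>R\<close> have no predecessors in the restriction;
  for the accessible ones the induction carries over.\<close>

lemma wfp_accp: "wfp (\<lambda>x y. R x y \<and> Wellfounded.accp R y)"
proof (rule accp_wfpI, rule allI)
  let ?Q = "\<lambda>x y. R x y \<and> Wellfounded.accp R y"
  fix x
  have "Wellfounded.accp ?Q y" if "Wellfounded.accp R y" for y
    using that by induction (auto intro: accp.accI)
  then show "Wellfounded.accp ?Q x"
    by (blast intro: accp.accI)
qed

text \<open>
  The multiset induction is on the restriction of the order to its accessible part, since
  well-foundedness of the whole order is not yet known.
\<close>

lemma accp_Node:
  assumes "wfp_on S lt" and "n \<in> S" and "\<forall>t\<in>#X. Wellfounded.accp (less_tree S lt) t"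
  shows "Wellfounded.accp (less_tree S lt) (Node n X)"
  using assms
proof (induction n arbitrary: X)
  case in_set
  then show ?case using assms(2) .
next
  case (less n)
  let ?acc = "Wellfounded.accp (less_tree S lt)"
  let ?R = "\<lambda>x y. less_tree S lt x y \<and> ?acc y"
  note IH_label = less.IH
  have "wfp (multp ?R)"
    by (intro wfp_multp wfp_accp)
  then show ?case
    using less.prems
  proof (induction X)
    case (less X)
    have "?acc (erase u)" if "reduct S lt (Node n X) u" for u
      using that
    proof (induction "Node n X" u)
      case (same T W Z)
      have W: "\<exists>t\<in>#T. ?R (erase w) t" if "w \<in># W" for w
      proof -
        from that same.hyps obtain t where t: "t \<in># T" "reduct S lt t w" by blast
        then have "?acc t" using same.hyps less.prems by auto
        with t show ?thesis unfolding less_tree_def by blast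
      qed
      then have "?acc (erase w)" if "w \<in># W" for w
        using that by (blast dest: accp_downward)
      then have "\<forall>t\<in>#Z + image_mset erase W. ?acc t"
        using same less.prems by auto
      \<comment> \<open>Since \<open>X\<close> is \<open>Z + T\<close> with \<open>T\<close>
        nonempty, replacing \<open>T\<close> by the erased \<open>W\<close> is one multiset
        descent.\<close>
      moreover have "multp ?R (Z + image_mset erase W) X"
        using W same one_step_implies_multp[of T "image_mset erase W" ?R Z] by auto
      ultimately have "?acc (Node n (Z + image_mset erase W))"
        using less.IH same.hyps(1) by blast
      then show ?case
        by (simp add: multiset.map_comp o_def)
    next
      \<comment> \<open>The children are accessible by the induction on the reduct, and the label
        \<open>m\<close> is below \<open>n\<close>.\<close>
      case (lower m U)
      then show ?case
        by (simp add: IH_label)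
    qed
    then show ?case
      unfolding less_tree_def by (blast intro: accp.accI)
  qed
qed

text \<open>A tree with root label outside \<open>S\<close> has no reducts; the others follow from
  \<open>accp_Node\<close> by induction on the tree.\<close>

lemma wfp_less_tree:
  assumes "wfp_on S lt"
  shows "wfp (less_tree S lt)"
proof (rule accp_wfpI, rule allI)
  fix t
  show "Wellfounded.accp (less_tree S lt) t"
  proof (induction t)
    case (Node n X)
    show ?case
    proof (cases "n \<in> S")
      case True
      then show ?thesis
        using accp_Node[OF assms] Node by blast
    next
      case False
      then have "\<not> reduct S lt (Node n X) u" for u
        by (auto elim!: reduct.cases)
      then show ?thesis
        unfolding less_tree_def by (blast intro: accp.accI)
    qed
  qed
qed

theorem theorem6p18:
  fixes S :: "'s set" and lt :: "'s \<Rightarrow> 's \<Rightarrow> bool"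
  assumes "irreflp_on S lt" and "transp_on S lt" and "wfp_on S lt"
  shows "\<not> (\<exists>h :: nat \<Rightarrow> 's tree. \<forall>i. star_hydra_step S lt (h i) (h (Suc i)))"
proof
  assume "\<exists>h. \<forall>i. star_hydra_step S lt (h i) (h (Suc i))"
  then have "\<exists>h. \<forall>i. less_tree S lt (h (Suc i)) (h i)"
    unfolding less_tree_def by (metis assms(2) star_hydra_step_reduct)
  then show False
    using wfp_less_tree[OF assms(3)] by (simp add: wfp_def wf_iff_no_infinite_down_chain)
qed

end
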